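(* Let $M$ be a pointed metric space, let $\{Y_i\}_{i\in I}$ be a family of Banach spaces, and let $Y=\left[\bigoplus_{i\in I}Y_i\right]_{c_0}$ or $Y=\left[\bigoplus_{i\in I}Y_i\right]_{\ell_\infty}$. Assume that for every $i\in I$ the pair $(M,Y_i)$ has the Lip-BPB property witnessed by a function $\eta_i(\varepsilon)$. If $\inf\{\eta_i(\varepsilon)\colon i\in I\}>0$ for every $\varepsilon>0$, then $(M,Y)$ has the Lip-BPB property.
   Context: All metric spaces are complete and all Banach spaces are real. A pointed metric space is a metric space $(M,d)$ with a distinguished point $0\in M$. $\mathrm{Lip}_0(M,Y)$ is the Banach space of Lipschitz maps $F\colon M\to Y$ with $F(0)=0$, with norm $\|F\|_L=\sup\{\|F(p)-F(q)\|/d(p,q)\colon p\neq q\}$. The pair $(M,Y)$ has the Lip-BPB property witnessed by a function $\varepsilon\mapsto\eta(\varepsilon)>0$ ($\varepsilon>0$) if for every $\varepsilon>0$, every $F\in\mathrm{Lip}_0(M,Y)$ with $\|F\|_L=1$ and all $p\neq q$ in $M$ with $\|F(p)-F(q)\|>(1-\eta(\varepsilon))d(p,q)$, there exist $G\in\mathrm{Lip}_0(M,Y)$ and $r\neq s$ in $M$ with $$\frac{\|G(r)-G(s)\|}{d(r,s)}=\|G\|_L=1,\qquad\|G-F\|_L<\varepsilon,\qquad\frac{d(p,r)+d(q,s)}{d(p,q)}<\varepsilon.$$ It has the Lip-BPB property if it has it witnessed by some such function. $\left[\bigoplus_{i\in I}Y_i\right]_{\ell_\infty}$ is the space of bounded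 families $(y_i)_{i\in I}$, $y_i\in Y_i$, with norm $\sup_i\|y_i\|$; $\left[\bigoplus_{i\in I}Y_i\right]_{c_0}$ is its closed subspace of families such that $\{i\in I\colon\|y_i\|>\delta\}$ is finite for every $\delta>0$. *)

theory Defs
  imports Complex_Main "HOL-Algebra.Module" "HOL-Library.Extended_Real"
begin

text \<open>
  The spaces of a family need not have a common HOL type class instance, so a Banach space is a
  structure with an explicit carrier. The ring fields \<open>mult\<close> and \<open>one\<close>, which every module record
  inherits, carry no meaning here.
\<close>

record 'b normed_space = "(real, 'b) module" +
  nrm :: "'b \<Rightarrow> real" ("\<nu>\<index>")

definition real_ring :: "real ring"
  where "real_ring = \<lparr>carrier = UNIV, mult = (*), one = 1, zero = 0, add = (+)\<rparr>"

locale banach_space = Module.module real_ring V for V :: "'b normed_space" (structure) +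
  assumes nrm_nonneg: "x \<in> carrier V \<Longrightarrow> 0 \<le> \<nu> x"
    and nrm_eq_0: "x \<in> carrier V \<Longrightarrow> \<nu> x = 0 \<longleftrightarrow> x = \<zero>"
    and nrm_triangle: "\<lbrakk>x \<in> carrier V; y \<in> carrier V\<rbrakk> \<Longrightarrow> \<nu> (x \<oplus> y) \<le> \<nu> x + \<nu> y"
    and nrm_smult: "x \<in> carrier V \<Longrightarrow> \<nu> (a \<odot> x) = \<bar>a\<bar> * \<nu> x"
    and complete: "\<lbrakk>\<And>n::nat. X n \<in> carrier V;
        \<And>e. e > 0 \<Longrightarrow> \<exists>N. \<forall>m\<ge>N. \<forall>n\<ge>N. \<nu> (X m \<ominus> X n) < e\<rbrakk>
      \<Longrightarrow> \<exists>l\<in>carrier V. (\<lambda>n. \<nu> (X n \<ominus> l)) \<longlonglongrightarrow> 0"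


text \<open>
  The metric space is the whole type \<open>'m\<close>, and its distinguished point is the parameter \<open>o\<^sub>M\<close>.
\<close>

definition Lip0 :: "'m::metric_space \<Rightarrow> 'b normed_space \<Rightarrow> ('m \<Rightarrow> 'b) set"
  where "Lip0 o\<^sub>M V = {F. (\<forall>p. F p \<in> carrier V) \<and> F o\<^sub>M = \<zero>\<^bsub>V\<^esub> \<and>
    (\<exists>L. \<forall>p q. \<nu>\<^bsub>V\<^esub> (F p \<ominus>\<^bsub>V\<^esub> F q) \<le> L * dist p q)}"

text \<open>
  Inserting 0 below only fixes the supremum of the empty set (one-point metric space, empty index
  set) to be 0; otherwise the supremum is over nonnegative numbers.
\<close>

definition lip_norm :: "'b normed_space \<Rightarrow> ('m::metric_space \<Rightarrow> 'b) \<Rightarrow> real"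
  where "lip_norm V F =
    Sup (insert 0 {\<nu>\<^bsub>V\<^esub> (F p \<ominus>\<^bsub>V\<^esub> F q) / dist p q | p q. p \<noteq> q})"

definition lip_BPB_witnessed ::
    "'m::metric_space \<Rightarrow> 'b normed_space \<Rightarrow> (real \<Rightarrow> real) \<Rightarrow> bool"
  where "lip_BPB_witnessed o\<^sub>M V \<eta> \<longleftrightarrow>
    (\<forall>\<epsilon>>0. \<eta> \<epsilon> > 0 \<and>
      (\<forall>F\<in>Lip0 o\<^sub>M V. \<forall>p q. lip_norm V F = 1 \<longrightarrow> p \<noteq> q \<longrightarrow>
        \<nu>\<^bsub>V\<^esub> (F p \<ominus>\<^bsub>V\<^esub> F q) > (1 - \<eta> \<epsilon>) * dist p q \<longrightarrow>
        (\<exists>G\<in>Lip0 o\<^sub>M V. \<exists>r s. r \<noteq> s \<and>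
          \<nu>\<^bsub>V\<^esub> (G r \<ominus>\<^bsub>V\<^esub> G s) / dist r s = lip_norm V G \<and> lip_norm V G = 1 \<and>
          lip_norm V (\<lambda>x. G x \<ominus>\<^bsub>V\<^esub> F x) < \<epsilon> \<and>
          (dist p r + dist q s) / dist p q < \<epsilon>)))"

definition lip_BPB :: "'m::metric_space \<Rightarrow> 'b normed_space \<Rightarrow> bool"
  where "lip_BPB o\<^sub>M V \<longleftrightarrow> (\<exists>\<eta>. lip_BPB_witnessed o\<^sub>M V \<eta>)"


definition linf_sum :: "'i set \<Rightarrow> ('i \<Rightarrow> 'b normed_space) \<Rightarrow> ('i \<Rightarrow> 'b) normed_space"
  where "linf_sum I Y =
    \<lparr>carrier = {y \<in> (\<Pi>\<^sub>E i\<in>I. carrier (Y i)). bdd_above ((\<lambda>i. \<nu>\<^bsub>Y i\<^esub> (y i)) ` I)},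
     mult = undefined, one = undefined,
     zero = (\<lambda>i\<in>I. \<zero>\<^bsub>Y i\<^esub>),
     add = (\<lambda>x y. \<lambda>i\<in>I. x i \<oplus>\<^bsub>Y i\<^esub> y i),
     smult = (\<lambda>a x. \<lambda>i\<in>I. a \<odot>\<^bsub>Y i\<^esub> x i),
     nrm = (\<lambda>y. Sup (insert 0 ((\<lambda>i. \<nu>\<^bsub>Y i\<^esub> (y i)) ` I)))\<rparr>"

definition c0_sum :: "'i set \<Rightarrow> ('i \<Rightarrow> 'b normed_space) \<Rightarrow> ('i \<Rightarrow> 'b) normed_space"
  where "c0_sum I Y = (linf_sum I Y)
    \<lparr>carrier := {y \<in> carrier (linf_sum I Y). \<forall>\<delta>>0. finite {i \<in> I. \<nu>\<^bsub>Y i\<^esub> (y i) > \<delta>}}\<rparr>"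

end

theory Submission
  imports Defs
begin

text \<open>
  If \<open>F\<close> almost attains its norm at the pair \<open>(p, q)\<close>, then so does some coordinate \<open>F\<^sub>i\<close>, whose norm
  is therefore close to 1. Applying the property of \<open>Y\<^sub>i\<close> to the normalisation of \<open>F\<^sub>i\<close> gives a
  norm-attaining map \<open>G\<^sub>i\<close> close to \<open>F\<^sub>i\<close>; replacing the single coordinate \<open>F\<^sub>i\<close> of \<open>F\<close> by \<open>G\<^sub>i\<close>
  yields the required \<open>G\<close>, since all the other coordinates have norm at most 1.
\<close>

section \<open>Rearranging differences in abelian groups\<close>

lemma (in abelian_group) minus_minus_swap:
  assumes "a \<in> carrier G" "b \<in> carrier G" "c \<in> carrier G" "d \<in> carrier G"
  shows "(a \<ominus> b) \<ominus> (c \<ominus> d) = (a \<ominus> c) \<ominus> (b \<ominus> d)"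
  using assms by (simp add: a_minus_def minus_add a_ac)

lemma (in abelian_group) minus_add_minus_cancel:
  assumes "a \<in> carrier G" "b \<in> carrier G" "c \<in> carrier G"
  shows "(a \<ominus> b) \<oplus> (b \<ominus> c) = a \<ominus> c"
  using assms by (simp add: a_minus_def a_assoc r_neg1)

section \<open>The Lipschitz norm as a supremum of slopes\<close>

lemma lip_norm_leI:
  assumes "0 \<le> c" and "\<And>p q. p \<noteq> q \<Longrightarrow> \<nu>\<^bsub>V\<^esub> (F p \<ominus>\<^bsub>V\<^esub> F q) \<le> c * dist p q"
  shows "lip_norm V F \<le> c"
  unfolding lip_norm_def
  by (rule cSup_least) (use assms in \<open>auto simp: pos_divide_le_eq\<close>)

text \<open>A real \<open>Sup\<close> dominates the elements of its set only if the set is bounded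
  above, so every upper estimate by \<open>lip_norm\<close> rests on this. The bound is
  \<open>max 0 L\<close> because 0 is inserted into the set and \<open>L\<close> may be negative,
  for instance on a one-point space.\<close>

lemma bdd_above_slopes:
  assumes "\<And>p q. \<nu>\<^bsub>V\<^esub> (F p \<ominus>\<^bsub>V\<^esub> F q) \<le> L * dist p q"
  shows "bdd_above (insert 0 {\<nu>\<^bsub>V\<^esub> (F p \<ominus>\<^bsub>V\<^esub> F q) / dist p q | p q. p \<noteq> q})"
  by (rule bdd_aboveI[of _ "max 0 L"]) (use assms in \<open>auto simp: pos_divide_le_eq le_max_iff_disj\<close>)

lemma lip_norm_nonneg:
  assumes "\<And>p q. \<nu>\<^bsub>V\<^esub> (F p \<ominus>\<^bsub>V\<^esub> F q) \<le> L * dist p q"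
  shows "0 \<le> lip_norm V F"
  unfolding lip_norm_def by (rule cSup_upper) (use bdd_above_slopes[of V F L] assms in auto)

lemma lip_norm_bound:
  assumes "\<And>p q. \<nu>\<^bsub>V\<^esub> (F p \<ominus>\<^bsub>V\<^esub> F q) \<le> L * dist p q" and "p \<noteq> q"
  shows "\<nu>\<^bsub>V\<^esub> (F p \<ominus>\<^bsub>V\<^esub> F q) \<le> lip_norm V F * dist p q"
proof -
  have "\<nu>\<^bsub>V\<^esub> (F p \<ominus>\<^bsub>V\<^esub> F q) / dist p q \<le> lip_norm V F"
    unfolding lip_norm_def
    by (rule cSup_upper) (use bdd_above_slopes[of V F L] assms in auto)
  then show ?thesis
    using assms(2) by (simp add: pos_divide_le_eq)
qed

lemma Lip0I:
  assumes "\<And>p. F p \<in> carrier V" and "F a = \<zero>\<^bsub>V\<^esub>"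
    and "\<And>p q. \<nu>\<^bsub>V\<^esub> (F p \<ominus>\<^bsub>V\<^esub> F q) \<le> L * dist p q"
  shows "F \<in> Lip0 a V"
  using assms unfolding Lip0_def by blast

lemma Lip0_lip_norm_nonneg: "F \<in> Lip0 a V \<Longrightarrow> 0 \<le> lip_norm V F"
  unfolding Lip0_def using lip_norm_nonneg by blast

lemma Lip0_lip_norm_bound:
  "F \<in> Lip0 a V \<Longrightarrow> p \<noteq> q \<Longrightarrow> \<nu>\<^bsub>V\<^esub> (F p \<ominus>\<^bsub>V\<^esub> F q) \<le> lip_norm V F * dist p q"
  unfolding Lip0_def using lip_norm_bound by blast

section \<open>One Banach space: norm estimates and maps of norm slightly below 1\<close>

context banach_space
begin

lemma real_ring_simps [simp]:
  "carrier real_ring = UNIV" "x \<oplus>\<^bsub>real_ring\<^esub> y = x + y" "x \<otimes>\<^bsub>real_ring\<^esub> y = x * y"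
  "\<one>\<^bsub>real_ring\<^esub> = 1" "\<zero>\<^bsub>real_ring\<^esub> = 0"
  by (simp_all add: real_ring_def)

lemma is_abelian_group: "abelian_group V"
  by (rule M.abelian_group_axioms)

lemma nrm_zero [simp]: "\<nu> \<zero> = 0"
  using nrm_eq_0 by blast

text \<open>Makes the homogeneity of the norm available for negatives. Additive inverses are unique,
  and (-1 + 1)x = 0.\<close>

lemma a_inv_eq_smult: "x \<in> carrier V \<Longrightarrow> \<ominus> x = (-1) \<odot> x"
proof (rule M.minus_equality)
  assume x: "x \<in> carrier V"
  have "(-1) \<odot> x \<oplus> x = (-1) \<odot> x \<oplus> 1 \<odot> x"
    using smult_one[OF x] by simp
  also have "\<dots> = (-1 + 1) \<odot> x"
    using smult_l_distr[of "-1" 1 x] x by simp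
  also have "\<dots> = \<zero>"
    using smult_l_null[OF x] by simp
  finally show "(-1) \<odot> x \<oplus> x = \<zero>" .
qed auto

lemma nrm_a_inv: "x \<in> carrier V \<Longrightarrow> \<nu> (\<ominus> x) = \<nu> x"
  by (simp add: a_inv_eq_smult nrm_smult)

lemma nrm_minus_le:
  "x \<in> carrier V \<Longrightarrow> y \<in> carrier V \<Longrightarrow> \<nu> (x \<ominus> y) \<le> \<nu> x + \<nu> y"
  using nrm_triangle[of x "\<ominus> y"] by (simp add: a_minus_def nrm_a_inv)

lemma nrm_minus_triangle:
  assumes "x \<in> carrier V" "y \<in> carrier V" "z \<in> carrier V"
  shows "\<nu> (x \<ominus> z) \<le> \<nu> (x \<ominus> y) + \<nu> (y \<ominus> z)"
  using nrm_triangle[of "x \<ominus> y" "y \<ominus> z"] assms by (simp add: M.minus_add_minus_cancel)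

lemma smult_minus_distrib:
  assumes "x \<in> carrier V" "y \<in> carrier V"
  shows "a \<odot> (x \<ominus> y) = a \<odot> x \<ominus> a \<odot> y"
  using assms by (simp add: a_minus_def smult_r_distr smult_r_minus)

lemma smult_minus_self:
  assumes "x \<in> carrier V"
  shows "a \<odot> x \<ominus> x = (a - 1) \<odot> x"
  using assms smult_l_distr[of a "-1" x] by (simp add: a_minus_def a_inv_eq_smult)

text \<open>The Lip-BPB property speaks of maps of norm exactly 1, whereas a coordinate of a
  norm-one map may have a smaller norm \<open>n\<close>. Almost attainment gives 1 - t < n, so
  normalising moves \<open>F\<close> by 1 - n < t; hence the error \<open>\<epsilon> + t\<close>.
  The estimate is stated for increments because it is used later inside a single coordinate of a
  sum.\<close>

lemma lip_BPB_near_unit_norm: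
  assumes BPB: "lip_BPB_witnessed a V \<eta>" and \<epsilon>: "\<epsilon> > 0"
    and F: "F \<in> Lip0 a V" and le1: "lip_norm V F \<le> 1"
    and t: "t \<le> \<eta> \<epsilon>" "t < 1"
    and pq: "p \<noteq> q" "\<nu> (F p \<ominus> F q) > (1 - t) * dist p q"
  obtains G r s where "G \<in> Lip0 a V" "r \<noteq> s" "\<nu> (G r \<ominus> G s) / dist r s = 1"
    "lip_norm V G = 1" "(dist p r + dist q s) / dist p q < \<epsilon>"
    "\<And>x y. x \<noteq> y \<Longrightarrow> \<nu> ((G x \<ominus> F x) \<ominus> (G y \<ominus> F y)) \<le> (\<epsilon> + t) * dist x y"
proof -
  define n where "n = lip_norm V F"
  define H where "H = (\<lambda>x. (1/n) \<odot> F x)"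
  have FV [simp]: "F x \<in> carrier V" for x
    using F by (simp add: Lip0_def)
  have HV [simp]: "H x \<in> carrier V" for x
    by (simp add: H_def)
  have Fb: "\<nu> (F x \<ominus> F y) \<le> n * dist x y" if "x \<noteq> y" for x y
    unfolding n_def using Lip0_lip_norm_bound[OF F that] .
  \<comment> \<open>The increment at \<open>(p, q)\<close> is at most \<open>n * dist p q\<close>,
    so almost attainment bounds \<open>n\<close> from below; \<open>t < 1\<close> then makes
    \<open>n\<close> positive and the division by it legitimate.\<close>
  have "(1 - t) * dist p q < n * dist p q"
    using pq(2) Fb[OF pq(1)] by (rule less_le_trans)
  then have nt: "1 - t < n"
    using pq(1) by simp
  then have n: "n > 0" "n \<le> 1"
    using t le1 by (auto simp: n_def)
  have diff: "H x \<ominus> H y = (1/n) \<odot> (F x \<ominus> F y)" for x y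
    by (simp add: H_def smult_minus_distrib)
  have nH: "\<nu> (H x \<ominus> H y) = \<nu> (F x \<ominus> F y) / n" for x y
    using n by (simp add: diff nrm_smult)
  have Hb: "\<nu> (H x \<ominus> H y) \<le> 1 * dist x y" for x y
  proof (cases "x = y")
    case False
    then show ?thesis
      using Fb[OF False] n by (simp add: nH pos_divide_le_eq mult.commute)
  qed (simp add: a_minus_def M.r_neg)
  have H0: "H a = \<zero>"
    using F by (simp add: H_def Lip0_def)
  have H: "H \<in> Lip0 a V"
    using HV H0 Hb by (rule Lip0I)
  have H1: "lip_norm V H = 1"
  proof (rule antisym)
    show "lip_norm V H \<le> 1"
      by (rule lip_norm_leI) (use Hb in auto)
    \<comment> \<open>The left-hand side is \<open>n\<close> itself, so cancelling \<open>n\<close>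
      gives the missing inequality.\<close>
    have "lip_norm V F \<le> n * lip_norm V H"
    proof (rule lip_norm_leI)
      show "0 \<le> n * lip_norm V H"
        using n Lip0_lip_norm_nonneg[OF H] by simp
      show "\<nu> (F x \<ominus> F y) \<le> n * lip_norm V H * dist x y" if "x \<noteq> y" for x y
        using Lip0_lip_norm_bound[OF H that] n by (simp add: nH pos_divide_le_eq mult_ac)
    qed
    then show "1 \<le> lip_norm V H"
      using n by (simp add: n_def[symmetric])
  qed
  \<comment> \<open>The pair \<open>(p, q)\<close> remains admissible for \<open>H\<close>: dividing
    by n \<le> 1 does not shrink the increment, and
    \<open>t \<le> \<eta> \<epsilon>\<close>.\<close>
  have "(1 - \<eta> \<epsilon>) * dist p q \<le> (1 - t) * dist p q"
    using t by (intro mult_right_mono) auto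
  also have "\<dots> < \<nu> (F p \<ominus> F q)"
    by (rule pq)
  also have "\<dots> \<le> \<nu> (H p \<ominus> H q)"
    using n mult_left_mono[OF n(2), of "\<nu> (F p \<ominus> F q)"] nrm_nonneg[of "F p \<ominus> F q"]
    by (simp add: nH pos_le_divide_eq)
  finally have "\<nu> (H p \<ominus> H q) > (1 - \<eta> \<epsilon>) * dist p q" .
  then obtain G r s where G: "G \<in> Lip0 a V" "r \<noteq> s" "\<nu> (G r \<ominus> G s) / dist r s = lip_norm V G"
      "lip_norm V G = 1" "lip_norm V (\<lambda>x. G x \<ominus> H x) < \<epsilon>"
      "(dist p r + dist q s) / dist p q < \<epsilon>"
    using BPB \<epsilon> H H1 pq(1) unfolding lip_BPB_witnessed_def by meson
  have GV [simp]: "G x \<in> carrier V" for x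
    using G(1) by (simp add: Lip0_def)
  \<comment> \<open>A crude constant, needed only to know that the slopes of G - H are bounded
    above; the sharp bound then comes from \<open>lip_norm_bound\<close> and the choice of
    \<open>G\<close>.\<close>
  have GHL: "\<nu> ((G x \<ominus> H x) \<ominus> (G y \<ominus> H y)) \<le> 2 * dist x y" for x y
  proof (cases "x = y")
    case False
    have "\<nu> ((G x \<ominus> G y) \<ominus> (H x \<ominus> H y)) \<le> \<nu> (G x \<ominus> G y) + \<nu> (H x \<ominus> H y)"
      by (rule nrm_minus_le) auto
    then show ?thesis
      using Lip0_lip_norm_bound[OF G(1) False] Hb[of x y] G(4)
      by (simp add: M.minus_minus_swap[of "G x" "H x"])
  qed (auto simp: a_minus_def M.r_neg)
  have "\<nu> ((G x \<ominus> F x) \<ominus> (G y \<ominus> F y)) \<le> (\<epsilon> + t) * dist x y" if "x \<noteq> y" for x y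
  proof -
    have "\<nu> ((G x \<ominus> F x) \<ominus> (G y \<ominus> F y)) = \<nu> ((G x \<ominus> G y) \<ominus> (F x \<ominus> F y))"
      by (simp add: M.minus_minus_swap)
    \<comment> \<open>The increments of \<open>H\<close> are inserted between those of
      \<open>G\<close> and \<open>F\<close>: the first distance costs \<epsilon>, the second costs
      \<open>t\<close>.\<close>
    also have "\<dots> \<le> \<nu> ((G x \<ominus> G y) \<ominus> (H x \<ominus> H y)) + \<nu> ((H x \<ominus> H y) \<ominus> (F x \<ominus> F y))"
      by (rule nrm_minus_triangle) auto
    also have "(G x \<ominus> G y) \<ominus> (H x \<ominus> H y) = (G x \<ominus> H x) \<ominus> (G y \<ominus> H y)"
      by (simp add: M.minus_minus_swap)
    also have "\<nu> \<dots> \<le> \<epsilon> * dist x y"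
    proof -
      have "\<nu> ((G x \<ominus> H x) \<ominus> (G y \<ominus> H y)) \<le> lip_norm V (\<lambda>x. G x \<ominus> H x) * dist x y"
        by (rule lip_norm_bound[of V "\<lambda>x. G x \<ominus> H x" 2, OF GHL that])
      also have "\<dots> \<le> \<epsilon> * dist x y"
        using G(5) by (intro mult_right_mono) auto
      finally show ?thesis .
    qed
    also have "\<nu> ((H x \<ominus> H y) \<ominus> (F x \<ominus> F y)) \<le> t * dist x y"
    proof -
      have "\<nu> ((H x \<ominus> H y) \<ominus> (F x \<ominus> F y)) = \<bar>1/n - 1\<bar> * \<nu> (F x \<ominus> F y)"
        unfolding diff by (simp add: smult_minus_self nrm_smult)
      also have "\<dots> \<le> \<bar>1/n - 1\<bar> * (n * dist x y)"
        using Fb[OF that] by (intro mult_left_mono) auto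
      \<comment> \<open>Since 0 < n \<le> 1, the absolute value is 1/n - 1.\<close>
      also have "\<dots> = (1 - n) * dist x y"
        using n by (simp add: field_simps)
      also have "\<dots> \<le> t * dist x y"
        using nt by (intro mult_right_mono) auto
      finally show ?thesis .
    qed
    finally show ?thesis
      by (simp add: algebra_simps)
  qed
  with G that show thesis
    by auto
qed

end

section \<open>Coordinatewise calculation in both kinds of sums\<close>

locale banach_sum =
  fixes I :: "'i set" and Y :: "'i \<Rightarrow> 'b normed_space" and Z :: "('i \<Rightarrow> 'b) normed_space"
  assumes banach: "i \<in> I \<Longrightarrow> banach_space (Y i)"
    and Z_cases: "Z = c0_sum I Y \<or> Z = linf_sum I Y"
begin

text \<open>\<open>c0_sum\<close> overrides only the carrier, so these formulas hold for both sums
  alike.\<close>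

lemma sum_simps:
  "\<zero>\<^bsub>Z\<^esub> = (\<lambda>i\<in>I. \<zero>\<^bsub>Y i\<^esub>)"
  "x \<oplus>\<^bsub>Z\<^esub> y = (\<lambda>i\<in>I. x i \<oplus>\<^bsub>Y i\<^esub> y i)"
  "\<nu>\<^bsub>Z\<^esub> y = Sup (insert 0 ((\<lambda>i. \<nu>\<^bsub>Y i\<^esub> (y i)) ` I))"
  using Z_cases by (auto simp: c0_sum_def linf_sum_def)

lemma carrierD:
  assumes "y \<in> carrier Z"
  shows "y \<in> (\<Pi>\<^sub>E i\<in>I. carrier (Y i))" "bdd_above ((\<lambda>i. \<nu>\<^bsub>Y i\<^esub> (y i)) ` I)"
  using assms Z_cases by (auto simp: c0_sum_def linf_sum_def)

lemma carrier_coord: "y \<in> carrier Z \<Longrightarrow> i \<in> I \<Longrightarrow> y i \<in> carrier (Y i)"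
  using carrierD(1) by auto

lemma nrm_coord_nonneg: "y \<in> carrier Z \<Longrightarrow> i \<in> I \<Longrightarrow> 0 \<le> \<nu>\<^bsub>Y i\<^esub> (y i)"
  using banach_space.nrm_nonneg[OF banach] carrier_coord by blast

lemma nrm_coord_le: "y \<in> carrier Z \<Longrightarrow> i \<in> I \<Longrightarrow> \<nu>\<^bsub>Y i\<^esub> (y i) \<le> \<nu>\<^bsub>Z\<^esub> y"
  unfolding sum_simps by (rule cSup_upper) (use carrierD(2) in auto)

lemma nrm_leI:
  assumes "0 \<le> c" and "\<And>i. i \<in> I \<Longrightarrow> \<nu>\<^bsub>Y i\<^esub> (y i) \<le> c"
  shows "\<nu>\<^bsub>Z\<^esub> y \<le> c"
  unfolding sum_simps by (rule cSup_least) (use assms in auto)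

text \<open>One closure criterion for both sums. The finitely many indices in \<open>J\<close>
  affect neither boundedness nor the finiteness of the sets where the norm exceeds \<delta>; outside
  \<open>J\<close>, a coordinate above \<delta> forces one of the two dominating coordinates above
  \<delta>/2. Empty \<open>J\<close> serves negation and subtraction, a singleton serves the
  replacement of one coordinate.\<close>

lemma carrier_dominated:
  assumes z: "z \<in> (\<Pi>\<^sub>E i\<in>I. carrier (Y i))" and x: "x \<in> carrier Z" and y: "y \<in> carrier Z"
    and J: "finite J"
    and le: "\<And>i. i \<in> I \<Longrightarrow> i \<notin> J \<Longrightarrow> \<nu>\<^bsub>Y i\<^esub> (z i) \<le> \<nu>\<^bsub>Y i\<^esub> (x i) + \<nu>\<^bsub>Y i\<^esub> (y i)"
  shows "z \<in> carrier Z"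
proof -
  have "bdd_above ((\<lambda>i. \<nu>\<^bsub>Y i\<^esub> (z i)) ` (I - J))"
    using le nrm_coord_le[OF x] nrm_coord_le[OF y]
    by (intro bdd_aboveI2[of _ _ "\<nu>\<^bsub>Z\<^esub> x + \<nu>\<^bsub>Z\<^esub> y"]) (fastforce intro: order_trans add_mono)
  moreover have "bdd_above ((\<lambda>i. \<nu>\<^bsub>Y i\<^esub> (z i)) ` J)"
    using J by simp
  ultimately have "bdd_above ((\<lambda>i. \<nu>\<^bsub>Y i\<^esub> (z i)) ` (I - J) \<union> (\<lambda>i. \<nu>\<^bsub>Y i\<^esub> (z i)) ` J)"
    by simp
  then have bdd: "bdd_above ((\<lambda>i. \<nu>\<^bsub>Y i\<^esub> (z i)) ` I)"
    by (rule bdd_above_mono) auto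
  from Z_cases show ?thesis
  proof
    assume "Z = linf_sum I Y"
    then show ?thesis
      using z bdd by (simp add: linf_sum_def)
  next
    assume Z: "Z = c0_sum I Y"
    have fin: "finite {i \<in> I. \<nu>\<^bsub>Y i\<^esub> (u i) > e}" if "u \<in> carrier Z" "e > 0" for u e
      using that by (simp add: Z c0_sum_def)
    have "finite {i \<in> I. \<nu>\<^bsub>Y i\<^esub> (z i) > \<delta>}" if "\<delta> > 0" for \<delta>
    proof (rule finite_subset)
      have "\<nu>\<^bsub>Y i\<^esub> (x i) > \<delta>/2 \<or> \<nu>\<^bsub>Y i\<^esub> (y i) > \<delta>/2"
        if "i \<in> I" "\<nu>\<^bsub>Y i\<^esub> (z i) > \<delta>" "i \<notin> J" for i
        using le[of i] that by linarith
      then show "{i \<in> I. \<nu>\<^bsub>Y i\<^esub> (z i) > \<delta>} \<subseteq>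
          J \<union> {i \<in> I. \<nu>\<^bsub>Y i\<^esub> (x i) > \<delta>/2} \<union> {i \<in> I. \<nu>\<^bsub>Y i\<^esub> (y i) > \<delta>/2}"
        by auto
      have "\<delta>/2 > 0"
        using that by simp
      then show "finite (J \<union> {i \<in> I. \<nu>\<^bsub>Y i\<^esub> (x i) > \<delta>/2} \<union> {i \<in> I. \<nu>\<^bsub>Y i\<^esub> (y i) > \<delta>/2})"
        by (intro finite_UnI fin x y J)
    qed
    then show ?thesis
      using z bdd by (simp add: Z c0_sum_def linf_sum_def)
  qed
qed

text \<open>The inverse in \<open>Z\<close> is a definite description over \<open>carrier Z\<close>.
  The coordinatewise negative must therefore be shown to lie in that carrier and to be the only
  solution there.\<close>

lemma a_inv_sum:
  assumes y: "y \<in> carrier Z"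
  shows "\<ominus>\<^bsub>Z\<^esub> y = (\<lambda>i\<in>I. \<ominus>\<^bsub>Y i\<^esub> y i)"
proof -
  have ab: "abelian_group (Y i)" if "i \<in> I" for i
    using banach_space.is_abelian_group[OF banach[OF that]] .
  let ?w = "\<lambda>i\<in>I. \<ominus>\<^bsub>Y i\<^esub> y i"
  have w: "?w \<in> carrier Z"
  \<comment> \<open>The criterion takes two dominating families; \<open>y\<close> fills both places,
    as norms are nonnegative.\<close>
  proof (rule carrier_dominated[OF _ y y, of _ "{}"])
    show "?w \<in> (\<Pi>\<^sub>E i\<in>I. carrier (Y i))"
      using abelian_group.a_inv_closed[OF ab] carrier_coord[OF y] by auto
    show "\<nu>\<^bsub>Y i\<^esub> (?w i) \<le> \<nu>\<^bsub>Y i\<^esub> (y i) + \<nu>\<^bsub>Y i\<^esub> (y i)" if "i \<in> I" for i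
      using banach_space.nrm_a_inv[OF banach[OF that] carrier_coord[OF y that]]
        nrm_coord_nonneg[OF y that] that by simp
  qed simp
  have "(THE w. w \<in> carrier Z \<and> y \<oplus>\<^bsub>Z\<^esub> w = \<zero>\<^bsub>Z\<^esub> \<and> w \<oplus>\<^bsub>Z\<^esub> y = \<zero>\<^bsub>Z\<^esub>) = ?w"
  proof (rule the_equality)
    show "?w \<in> carrier Z \<and> y \<oplus>\<^bsub>Z\<^esub> ?w = \<zero>\<^bsub>Z\<^esub> \<and> ?w \<oplus>\<^bsub>Z\<^esub> y = \<zero>\<^bsub>Z\<^esub>"
      using w abelian_group.r_neg[OF ab] abelian_group.l_neg[OF ab] carrier_coord[OF y]
      by (auto simp: sum_simps fun_eq_iff)
  next
    fix w assume w: "w \<in> carrier Z \<and> y \<oplus>\<^bsub>Z\<^esub> w = \<zero>\<^bsub>Z\<^esub> \<and> w \<oplus>\<^bsub>Z\<^esub> y = \<zero>\<^bsub>Z\<^esub>"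
    show "w = ?w"
    proof
      fix i
      show "w i = ?w i"
      proof (cases "i \<in> I")
        case True
        have "(w \<oplus>\<^bsub>Z\<^esub> y) i = \<zero>\<^bsub>Z\<^esub> i"
          using w by simp
        then have "w i \<oplus>\<^bsub>Y i\<^esub> y i = \<zero>\<^bsub>Y i\<^esub>"
          using True by (simp add: sum_simps)
        then have "\<ominus>\<^bsub>Y i\<^esub> y i = w i"
          by (rule abelian_group.minus_equality[OF ab[OF True]])
            (use carrier_coord True w y in auto)
        then show ?thesis
          using True by simp
      next
        \<comment> \<open>Off \<open>I\<close> both functions are \<open>undefined\<close>, since
          elements of the carrier are extensional.\<close>
        case False
        then show ?thesis
          using carrierD(1)[of w] w by auto
      qed
    qed
  qed
  then show ?thesis
    by (simp add: a_inv_def m_inv_def)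
qed

lemma a_minus_sum:
  "y \<in> carrier Z \<Longrightarrow> x \<ominus>\<^bsub>Z\<^esub> y = (\<lambda>i\<in>I. x i \<ominus>\<^bsub>Y i\<^esub> y i)"
  by (auto simp: a_minus_def a_inv_sum sum_simps fun_eq_iff)

lemma a_minus_in_carrier:
  assumes x: "x \<in> carrier Z" and y: "y \<in> carrier Z"
  shows "x \<ominus>\<^bsub>Z\<^esub> y \<in> carrier Z"
proof (rule carrier_dominated[OF _ x y, of _ "{}"])
  have ab: "abelian_group (Y i)" if "i \<in> I" for i
    using banach_space.is_abelian_group[OF banach[OF that]] .
  show "x \<ominus>\<^bsub>Z\<^esub> y \<in> (\<Pi>\<^sub>E i\<in>I. carrier (Y i))"
    using abelian_group.minus_closed[OF ab] carrier_coord[OF x] carrier_coord[OF y]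
    by (auto simp: a_minus_sum[OF y])
  show "\<nu>\<^bsub>Y i\<^esub> ((x \<ominus>\<^bsub>Z\<^esub> y) i) \<le> \<nu>\<^bsub>Y i\<^esub> (x i) + \<nu>\<^bsub>Y i\<^esub> (y i)" if "i \<in> I" for i
    using banach_space.nrm_minus_le[OF banach[OF that]] carrier_coord[OF x that]
      carrier_coord[OF y that] that
    by (simp add: a_minus_sum[OF y])
qed simp

section \<open>Coordinate maps and the replacement of one coordinate\<close>

lemma Lip0_coord:
  assumes F: "F \<in> Lip0 a Z" and i: "i \<in> I"
  shows "(\<lambda>x. F x i) \<in> Lip0 a (Y i)" "lip_norm (Y i) (\<lambda>x. F x i) \<le> lip_norm Z F"
proof -
  have FZ: "F x \<in> carrier Z" for x
    using F by (simp add: Lip0_def)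
  have le: "\<nu>\<^bsub>Y i\<^esub> (F x i \<ominus>\<^bsub>Y i\<^esub> F y i) \<le> \<nu>\<^bsub>Z\<^esub> (F x \<ominus>\<^bsub>Z\<^esub> F y)" for x y
    using nrm_coord_le[OF a_minus_in_carrier[OF FZ FZ] i, of x y] i by (simp add: a_minus_sum FZ)
  obtain L where "\<And>x y. \<nu>\<^bsub>Z\<^esub> (F x \<ominus>\<^bsub>Z\<^esub> F y) \<le> L * dist x y"
    using F by (auto simp: Lip0_def)
  then have "\<And>x y. \<nu>\<^bsub>Y i\<^esub> (F x i \<ominus>\<^bsub>Y i\<^esub> F y i) \<le> L * dist x y"
    using le order_trans by blast
  then show "(\<lambda>x. F x i) \<in> Lip0 a (Y i)"
    using F i carrier_coord[OF FZ i] by (auto simp: Lip0_def sum_simps)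
  show "lip_norm (Y i) (\<lambda>x. F x i) \<le> lip_norm Z F"
    by (rule lip_norm_leI[OF Lip0_lip_norm_nonneg[OF F]])
      (rule order_trans[OF le Lip0_lip_norm_bound[OF F]])
qed

text \<open>A supremum above \<open>c\<close> has a member above \<open>c\<close>, and
  \<open>0 \<le> c\<close> keeps that member from being the inserted 0. Almost attainment thus
  passes to a coordinate with the same constant.\<close>

lemma nrm_gt_coord:
  assumes "0 \<le> c" and "c < \<nu>\<^bsub>Z\<^esub> y"
  obtains i where "i \<in> I" "c < \<nu>\<^bsub>Y i\<^esub> (y i)"
  using nrm_leI[OF assms(1), of y] assms(2) by (meson not_le)

text \<open>The case of a single \<epsilon>. The property of the coordinate is invoked at
  \<epsilon>/2, leaving room for the normalisation error: \<epsilon>/2 + t < \<epsilon>.\<close>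

lemma lip_BPB_step:
  fixes a :: "'m::metric_space"
  assumes BPB: "\<And>i. i \<in> I \<Longrightarrow> lip_BPB_witnessed a (Y i) (\<eta> i)"
    and t: "0 < t" "t < 1" "t < \<epsilon>/2" "\<And>i. i \<in> I \<Longrightarrow> t \<le> \<eta> i (\<epsilon>/2)"
    and F: "F \<in> Lip0 a Z" "lip_norm Z F = 1"
    and pq: "p \<noteq> q" "\<nu>\<^bsub>Z\<^esub> (F p \<ominus>\<^bsub>Z\<^esub> F q) > (1 - t) * dist p q"
  shows "\<exists>G\<in>Lip0 a Z. \<exists>r s. r \<noteq> s \<and>
          \<nu>\<^bsub>Z\<^esub> (G r \<ominus>\<^bsub>Z\<^esub> G s) / dist r s = lip_norm Z G \<and> lip_norm Z G = 1 \<and>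
          lip_norm Z (\<lambda>x. G x \<ominus>\<^bsub>Z\<^esub> F x) < \<epsilon> \<and>
          (dist p r + dist q s) / dist p q < \<epsilon>"
proof -
  have FZ: "F x \<in> carrier Z" for x
    using F by (simp add: Lip0_def)
  have "0 \<le> (1 - t) * dist p q"
    using t by simp
  then obtain i where i: "i \<in> I" and "(1 - t) * dist p q < \<nu>\<^bsub>Y i\<^esub> ((F p \<ominus>\<^bsub>Z\<^esub> F q) i)"
    using nrm_gt_coord[OF _ pq(2)] by blast
  then have gt: "(1 - t) * dist p q < \<nu>\<^bsub>Y i\<^esub> (F p i \<ominus>\<^bsub>Y i\<^esub> F q i)"
    by (simp add: a_minus_sum FZ)
  have \<epsilon>: "\<epsilon>/2 > 0"
    using t by linarith
  have Fi1: "lip_norm (Y i) (\<lambda>x. F x i) \<le> 1"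
    using Lip0_coord(2)[OF F(1) i] F(2) by simp
  obtain g r s where g: "g \<in> Lip0 a (Y i)" "r \<noteq> s" "\<nu>\<^bsub>Y i\<^esub> (g r \<ominus>\<^bsub>Y i\<^esub> g s) / dist r s = 1"
    "lip_norm (Y i) g = 1" "(dist p r + dist q s) / dist p q < \<epsilon>/2"
    and gF: "\<And>x y. x \<noteq> y \<Longrightarrow>
      \<nu>\<^bsub>Y i\<^esub> ((g x \<ominus>\<^bsub>Y i\<^esub> F x i) \<ominus>\<^bsub>Y i\<^esub> (g y \<ominus>\<^bsub>Y i\<^esub> F y i)) \<le> (\<epsilon>/2 + t) * dist x y"
    using banach_space.lip_BPB_near_unit_norm[OF banach[OF i] BPB[OF i] \<epsilon> Lip0_coord(1)[OF F(1) i]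
      Fi1 t(4)[OF i] t(2) pq(1) gt] by blast
  define G where "G = (\<lambda>x. (F x)(i := g x))"
  have gi: "g x \<in> carrier (Y i)" for x
    using g(1) by (simp add: Lip0_def)
  have GZ: "G x \<in> carrier Z" for x
  \<comment> \<open>\<open>G x\<close> differs from \<open>F x\<close> only at \<open>i\<close>, so
    it stays in the carrier, also for the c0 sum.\<close>
  proof (rule carrier_dominated[OF _ FZ FZ, of _ "{i}"])
    show "G x \<in> (\<Pi>\<^sub>E j\<in>I. carrier (Y j))"
      using carrierD(1)[OF FZ, of x] gi i by (auto simp: G_def PiE_iff extensional_def)
    show "\<nu>\<^bsub>Y j\<^esub> (G x j) \<le> \<nu>\<^bsub>Y j\<^esub> (F x j) + \<nu>\<^bsub>Y j\<^esub> (F x j)" if "j \<in> I" "j \<notin> {i}" for j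
      using nrm_coord_nonneg[OF FZ that(1), of x] that by (simp add: G_def)
  qed simp
  have le: "\<nu>\<^bsub>Z\<^esub> (G x \<ominus>\<^bsub>Z\<^esub> G y) \<le> 1 * dist x y" if "x \<noteq> y" for x y
  proof (rule nrm_leI)
    fix j assume j: "j \<in> I"
    show "\<nu>\<^bsub>Y j\<^esub> ((G x \<ominus>\<^bsub>Z\<^esub> G y) j) \<le> 1 * dist x y"
    proof (cases "j = i")
      case True
      then show ?thesis
        using Lip0_lip_norm_bound[OF g(1) that] i g(4) by (simp add: a_minus_sum GZ) (simp add: G_def)
    next
      case False
      have "\<nu>\<^bsub>Y j\<^esub> (F x j \<ominus>\<^bsub>Y j\<^esub> F y j) \<le> lip_norm (Y j) (\<lambda>x. F x j) * dist x y"
        by (rule Lip0_lip_norm_bound[OF Lip0_coord(1)[OF F(1) j] that])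
      also have "\<dots> \<le> 1 * dist x y"
        using Lip0_coord(2)[OF F(1) j] F(2) by (intro mult_right_mono) auto
      finally show ?thesis
        using j False by (simp add: a_minus_sum GZ) (simp add: G_def)
    qed
  qed simp
  have self0: "\<nu>\<^bsub>Y j\<^esub> (u \<ominus>\<^bsub>Y j\<^esub> u) = 0" if "j \<in> I" "u \<in> carrier (Y j)" for j u
  proof -
    interpret banach_space "Y j" by (rule banach[OF that(1)])
    show ?thesis using that(2) by (simp add: a_minus_def M.r_neg)
  qed
  have G0: "G a = \<zero>\<^bsub>Z\<^esub>"
    using F(1) g(1) i by (auto simp: G_def Lip0_def sum_simps fun_eq_iff)
  \<comment> \<open>Membership in \<open>Lip0\<close> also asks for the bound on the diagonal, which
    \<open>le\<close> leaves out.\<close>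
  have "\<nu>\<^bsub>Z\<^esub> (G x \<ominus>\<^bsub>Z\<^esub> G x) \<le> 0" for x
    by (rule nrm_leI) (use self0 carrier_coord[OF GZ] in \<open>auto simp: a_minus_sum GZ\<close>)
  then have leL: "\<nu>\<^bsub>Z\<^esub> (G x \<ominus>\<^bsub>Z\<^esub> G y) \<le> 1 * dist x y" for x y
    using le[of x y] by (cases "x = y") auto
  have G: "G \<in> Lip0 a Z"
    using GZ G0 leL by (rule Lip0I)
  have G1: "lip_norm Z G \<le> 1"
    by (rule lip_norm_leI) (use le in auto)
  \<comment> \<open>Coordinate \<open>i\<close> alone already gives the increment norm
    \<open>dist r s\<close>, and \<open>le\<close> excludes more. So \<open>G\<close> has slope 1 at
    \<open>(r, s)\<close>, which with \<open>G1\<close> fixes its norm.\<close>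
  have "dist r s = \<nu>\<^bsub>Y i\<^esub> (g r \<ominus>\<^bsub>Y i\<^esub> g s)"
    using g(2,3) by (simp add: divide_eq_eq)
  also have "\<dots> = \<nu>\<^bsub>Y i\<^esub> ((G r \<ominus>\<^bsub>Z\<^esub> G s) i)"
    using i by (simp add: a_minus_sum GZ) (simp add: G_def)
  also have "\<dots> \<le> \<nu>\<^bsub>Z\<^esub> (G r \<ominus>\<^bsub>Z\<^esub> G s)"
    by (rule nrm_coord_le[OF a_minus_in_carrier[OF GZ GZ] i])
  finally have attain: "\<nu>\<^bsub>Z\<^esub> (G r \<ominus>\<^bsub>Z\<^esub> G s) = dist r s"
    using le[OF g(2)] by simp
  have "dist r s \<le> lip_norm Z G * dist r s"
    using Lip0_lip_norm_bound[OF G g(2)] attain by simp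
  with g(2) G1 have G1': "lip_norm Z G = 1"
    by simp
  have "lip_norm Z (\<lambda>x. G x \<ominus>\<^bsub>Z\<^esub> F x) \<le> \<epsilon>/2 + t"
  proof (rule lip_norm_leI)
    show "0 \<le> \<epsilon>/2 + t"
      using \<epsilon> t by simp
    fix x y :: 'm assume xy: "x \<noteq> y"
    show "\<nu>\<^bsub>Z\<^esub> ((G x \<ominus>\<^bsub>Z\<^esub> F x) \<ominus>\<^bsub>Z\<^esub> (G y \<ominus>\<^bsub>Z\<^esub> F y)) \<le> (\<epsilon>/2 + t) * dist x y"
    proof (rule nrm_leI)
      show "0 \<le> (\<epsilon>/2 + t) * dist x y"
        using \<epsilon> t by simp
      fix j assume j: "j \<in> I"
      have eq: "((G x \<ominus>\<^bsub>Z\<^esub> F x) \<ominus>\<^bsub>Z\<^esub> (G y \<ominus>\<^bsub>Z\<^esub> F y)) j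
          = (G x j \<ominus>\<^bsub>Y j\<^esub> F x j) \<ominus>\<^bsub>Y j\<^esub> (G y j \<ominus>\<^bsub>Y j\<^esub> F y j)"
        unfolding a_minus_sum[OF a_minus_in_carrier[OF GZ FZ]] using j by (simp add: a_minus_sum[OF FZ])
      show "\<nu>\<^bsub>Y j\<^esub> (((G x \<ominus>\<^bsub>Z\<^esub> F x) \<ominus>\<^bsub>Z\<^esub> (G y \<ominus>\<^bsub>Z\<^esub> F y)) j) \<le> (\<epsilon>/2 + t) * dist x y"
      proof (cases "j = i")
        case True
        then show ?thesis
          unfolding eq using gF[OF xy] by (simp add: G_def)
      next
        case False
        interpret banach_space "Y j" by (rule banach[OF j])
        \<comment> \<open>\<open>G\<close> and \<open>F\<close> agree in this coordinate, so only
          the norm of zero minus zero remains.\<close>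
        have "F x j \<ominus>\<^bsub>Y j\<^esub> F x j = \<zero>\<^bsub>Y j\<^esub>" for x
          using carrier_coord[OF FZ j] by (simp add: a_minus_def M.r_neg)
        then show ?thesis
          unfolding eq using False \<epsilon> t by (simp add: G_def self0[OF j])
      qed
    qed
  qed
  then have "lip_norm Z (\<lambda>x. G x \<ominus>\<^bsub>Z\<^esub> F x) < \<epsilon>"
    using t(3) by linarith
  moreover have "(dist p r + dist q s) / dist p q < \<epsilon>"
    using g(5) \<epsilon> by linarith
  ultimately show ?thesis
    using G g(2) attain G1' by (intro bexI[of _ G] exI[of _ r] exI[of _ s]) auto
qed

end

section \<open>A modulus uniform in the index\<close>

theorem proposition4p9:
  fixes o\<^sub>M :: "'m::complete_space"
    and I :: "'i set"
    and Y :: "'i \<Rightarrow> 'b normed_space"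
    and Z :: "('i \<Rightarrow> 'b) normed_space"
    and \<eta> :: "'i \<Rightarrow> real \<Rightarrow> real"
  assumes "\<And>i. i \<in> I \<Longrightarrow> banach_space (Y i)"
    and "Z = c0_sum I Y \<or> Z = linf_sum I Y"
    and "\<And>i. i \<in> I \<Longrightarrow> lip_BPB_witnessed o\<^sub>M (Y i) (\<eta> i)"
    and "\<And>\<epsilon>. \<epsilon> > 0 \<Longrightarrow> (INF i\<in>I. ereal (\<eta> i \<epsilon>)) > 0"
  shows "lip_BPB o\<^sub>M Z"
proof -
  interpret banach_sum I Y Z
    using assms(1,2) by (rule banach_sum.intro)
  have "\<exists>t>0. t < 1 \<and> t < \<epsilon>/2 \<and> (\<forall>i\<in>I. t \<le> \<eta> i (\<epsilon>/2))" if \<epsilon>: "\<epsilon> > 0" for \<epsilon> :: real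
  proof -
    \<comment> \<open>The infimum is infinite when \<open>I\<close> is empty; density still yields a
      positive real below it.\<close>
    obtain c where c: "0 < ereal c" "ereal c < (INF i\<in>I. ereal (\<eta> i (\<epsilon>/2)))"
      using ereal_dense2[OF assms(4)[of "\<epsilon>/2"]] \<epsilon> by auto
    have "c \<le> \<eta> i (\<epsilon>/2)" if "i \<in> I" for i
      using less_INF_D[OF c(2) that] by simp
    then show ?thesis
      \<comment> \<open>The entries of the minimum secure, in order, the bound by every \<eta>,
        \<open>t < 1\<close> and \<open>t < \<epsilon>/2\<close>.\<close>
      using c(1) \<epsilon> by (intro exI[of _ "min c (min (1/2) (\<epsilon>/4))"]) (auto simp: min_le_iff_disj)
  qed
  \<comment> \<open>Choosing such a number for each \<epsilon> gives the function that witnesses the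
    property of \<open>Z\<close>.\<close>
  then obtain t where t: "\<And>\<epsilon>. \<epsilon> > 0 \<Longrightarrow> 0 < t \<epsilon>" "\<And>\<epsilon>. \<epsilon> > 0 \<Longrightarrow> t \<epsilon> < 1"
      "\<And>\<epsilon>. \<epsilon> > 0 \<Longrightarrow> t \<epsilon> < \<epsilon>/2" "\<And>\<epsilon> i. \<epsilon> > 0 \<Longrightarrow> i \<in> I \<Longrightarrow> t \<epsilon> \<le> \<eta> i (\<epsilon>/2)"
    by metis
  have "lip_BPB_witnessed o\<^sub>M Z t"
    unfolding lip_BPB_witnessed_def
  proof (intro allI impI conjI ballI)
    fix \<epsilon> :: real and F p q
    assume \<epsilon>: "\<epsilon> > 0"
    then show "0 < t \<epsilon>"
      by (rule t)
    assume "F \<in> Lip0 o\<^sub>M Z" "lip_norm Z F = 1" "p \<noteq> q"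
      "(1 - t \<epsilon>) * dist p q < \<nu>\<^bsub>Z\<^esub> (F p \<ominus>\<^bsub>Z\<^esub> F q)"
    with assms(3) t[OF \<epsilon>] show "\<exists>G\<in>Lip0 o\<^sub>M Z. \<exists>r s. r \<noteq> s \<and>
          \<nu>\<^bsub>Z\<^esub> (G r \<ominus>\<^bsub>Z\<^esub> G s) / dist r s = lip_norm Z G \<and> lip_norm Z G = 1 \<and>
          lip_norm Z (\<lambda>x. G x \<ominus>\<^bsub>Z\<^esub> F x) < \<epsilon> \<and>
          (dist p r + dist q s) / dist p q < \<epsilon>"
      by (rule lip_BPB_step)
  qed
  then show ?thesis
    unfolding lip_BPB_def by blast
qed

end
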